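(* For every integer $m\ge 0$, $$\sum_{k=1}^\infty (\zeta(2k+1)-1) F_{2k+m}= \frac{F_{m}+F_{m+2}}{2}- F_{m}\frac{\pi}{\sqrt{5}}\tan\!\Big(\frac{\sqrt{5}\,\pi}{2}\Big)-\frac{F_{m}}{2} \sum_{n=1}^\infty \frac{1}{n(n+1)(n^2+3n+1)}$$ and $$\sum_{k=1}^\infty (\zeta(2k+1)-1) L_{2k+m} = \frac{L_{m}+L_{m+2}}{2}- L_{m}\frac{\pi}{\sqrt{5}}\tan\!\Big(\frac{\sqrt{5}\,\pi}{2}\Big)-\frac{L_{m}}{2} \sum_{n=1}^\infty \frac{1}{n(n+1)(n^2+3n+1)}.$$
   Context: $\zeta$ is the Riemann zeta function, $\zeta(s)=\sum_{n\ge1} n^{-s}$ for $\Re(s)>1$. The Fibonacci numbers $F_n$ and Lucas numbers $L_n$ are defined by $F_0=0$, $F_1=1$, $L_0=2$, $L_1=1$, $F_{n+2}=F_{n+1}+F_n$, $L_{n+2}=L_{n+1}+L_n$. *)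

theory Defs
  imports "HOL-Analysis.Analysis" "HOL-Number_Theory.Fib"
begin

text \<open>
  Only the half-plane \<open>Re s > 1\<close> is meaningful here: there the series converges and its sum is the
  Riemann zeta function. Elsewhere the value carries no information (no analytic continuation).
\<close>
definition zeta :: "complex \<Rightarrow> complex" where
  "zeta s = (\<Sum>n. of_nat (Suc n) powr (- s))"

fun lucas :: "nat \<Rightarrow> nat" where
  "lucas 0 = 2"
| "lucas (Suc 0) = 1"
| "lucas (Suc (Suc n)) = lucas (Suc n) + lucas n"

end

theory Submission
  imports Defs "HOL-Real_Asymp.Real_Asymp"
begin

text \<open>
  Let \<open>g\<close> satisfy the Fibonacci recurrence, with \<open>a = g m\<close> and \<open>b = g (m + 2)\<close>. Writing
  \<open>\<zeta>(2k+1) - 1\<close> as the sum of \<open>1 / N\<^sup>2\<^sup>k\<^sup>+\<^sup>1\<close> over \<open>N \<ge> 2\<close> turns the left-hand side into a double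
  series of nonnegative terms, so the order of summation may be exchanged
  (\<open>sums_swap_nonneg\<close>). The sum over \<open>k\<close> for fixed \<open>N\<close> is a rational function, because every
  second term of \<open>g\<close> again satisfies a linear recurrence, \<open>g (n + 4) = 3 g (n + 2) - g n\<close>
  (\<open>sums_fibonacci_like_even\<close>). With \<open>P y = y\<^sup>2 - y - 1\<close> the result is
  \<open>(b N\<^sup>2 - a) / (N P(N) P(N + 1))\<close>.

  The denominator factors in this way since \<open>y\<^sup>4 - 3 y\<^sup>2 + 1 = P(y) P(y + 1)\<close>, and the
  partial fractions over \<open>P(N)\<close> and \<open>P(N + 1)\<close> can be compared after a shift of \<open>N\<close>. What remains after
  removing a telescoping part is \<open>- a / 2\<close> times the sum of two terms
  (\<open>partial_fractions_telescoping\<close>): the quartic reciprocal that appears in the theorem and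
  \<open>2 / P(N + 1)\<close>. The telescoping part contributes \<open>(a + b) / 2\<close>.

  The series of \<open>1 / P(N)\<close> gives the tangent. The roots of \<open>P\<close> are the golden ratio \<open>\<phi>\<close> and \<open>1 - \<phi>\<close>,
  so \<open>1 / P(N)\<close> splits into exactly the pair of terms that appears in the partial fraction
  expansion of \<open>\<pi> cot (\<pi> \<phi>)\<close>, and \<open>cot (\<pi> \<phi>) = - tan (\<surd>5 \<pi> / 2)\<close>. The expansion itself is
  the reflection formula of the digamma function, written as a difference of two digamma series.

  The Fibonacci and Lucas numbers are two sequences with this recurrence, and the two identities are
  instances of \<open>sums_zeta_fibonacci_like\<close>.
\<close>

section \<open>The partial fraction expansion of the cotangent\<close>

text \<open>
  This is the derivative of the reflection formula of the reciprocal Gamma function, divided by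
  the formula itself. The reciprocal is entire and vanishes exactly at the nonpositive integers,
  so excluding \<open>\<int>\<close> is what makes the division possible.
\<close>
lemma Digamma_reflection_complex:
  fixes z :: complex
  assumes "z \<notin> \<int>"
  shows "Digamma (1 - z) - Digamma z = of_real pi * cot (of_real pi * z)"
proof -
  have z: "z \<notin> \<int>\<^sub>\<le>\<^sub>0" and z': "1 - z \<notin> \<int>\<^sub>\<le>\<^sub>0"
    using assms by (auto simp: nonpos_Ints_def minus_in_Ints_iff) (metis Ints_1 Ints_diff Ints_of_int diff_diff_eq2 add_diff_cancel_left')
  have "((\<lambda>w. rGamma w * rGamma (1 - w)) has_field_derivative
          rGamma z * rGamma (1 - z) * (Digamma (1 - z) - Digamma z)) (at z)"
    using z z' by (auto intro!: derivative_eq_intros simp: algebra_simps)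
  moreover have "((\<lambda>w. sin (of_real pi * w) / of_real pi) has_field_derivative
          cos (of_real pi * z)) (at z)"
    by (auto intro!: derivative_eq_intros)
  ultimately have "rGamma z * rGamma (1 - z) * (Digamma (1 - z) - Digamma z) = cos (of_real pi * z)"
    unfolding rGamma_reflection_complex by (rule DERIV_unique)
  moreover have "rGamma z * rGamma (1 - z) \<noteq> 0"
    using z z' by (simp add: rGamma_eq_zero_iff)
  ultimately show ?thesis
    unfolding rGamma_reflection_complex cot_def by (simp add: field_simps)
qed

text \<open>
  Subtracting the defining series of the digamma function at \<open>z\<close> and at \<open>1 - z\<close> cancels both the
  harmonic terms and the Euler-Mascheroni constant.
\<close>
lemma cot_partial_fractions_complex:
  fixes z :: complex
  assumes "z \<notin> \<int>"
  shows "(\<lambda>n. 1 / (z + of_nat n) - 1 / (of_nat (Suc n) - z)) sums (of_real pi * cot (of_real pi * z))"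
proof -
  have nz: "w \<noteq> 0 \<Longrightarrow> (\<lambda>n. inverse (of_nat (Suc n)) - inverse (w + of_nat n))
              sums (Digamma w + euler_mascheroni)" for w :: complex
    using summable_Digamma[of w] by (simp add: Digamma_def summable_sums)
  have "z \<noteq> 0" "1 - z \<noteq> 0" using assms by auto
  from sums_diff[OF nz[OF this(2)] nz[OF this(1)]] show ?thesis
    unfolding Digamma_reflection_complex[OF assms, symmetric] by (simp add: inverse_eq_divide algebra_simps)
qed

lemma cot_partial_fractions_real:
  fixes x :: real
  assumes "x \<notin> \<int>"
  shows "(\<lambda>n. 1 / (x + real n) - 1 / (real (Suc n) - x)) sums (pi * cot (pi * x))"
proof -
  have "complex_of_real x \<notin> \<int>"
    using assms by (auto elim!: Ints_cases simp: complex_eq_iff)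
  from cot_partial_fractions_complex[OF this] 
  have "(\<lambda>n. complex_of_real (1 / (x + real n) - 1 / (real (Suc n) - x))) sums of_real (pi * cot (pi * x))"
    by (simp add: cot_def flip: sin_of_real cos_of_real)
  thus ?thesis unfolding sums_of_real_iff .
qed

section \<open>The series of reciprocals\<close>

text \<open>
  The golden ratio \<open>x\<close> satisfies \<open>y\<^sup>2 - y - 1 = (y - 1 + x) (y - x)\<close>, so for \<open>y = n + 1\<close> the reciprocal is,
  up to the factor \<open>- 1 / \<surd>5\<close>, a term of the cotangent expansion at \<open>x\<close>. The terms for
  \<open>y = 1\<close> and \<open>y = 2\<close> are \<open>-1\<close> and \<open>1\<close>, so the series may start at \<open>y = 3\<close> without changing its value.
\<close>
lemma sums_inverse_golden_polynomial:
  "(\<lambda>n. 1 / ((real n + 3)\<^sup>2 - (real n + 3) - 1)) sums (pi / sqrt 5 * tan (sqrt 5 * pi / 2))"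
proof -
  define s where "s = sqrt 5"
  define x where "x = (1 + s) / 2"
  have s2: "s * s = 5" unfolding s_def by simp
  have s: "2 < s" "s < 3" unfolding s_def by (auto intro: real_less_rsqrt real_less_lsqrt)
  have x: "1 < x" "x < 2" using s by (auto simp: x_def)
  have nI: "x \<notin> \<int>"
  proof
    assume "x \<in> \<int>"
    then obtain k where "x = of_int k" by (auto elim: Ints_cases)
    with x show False by simp
  qed
  have cot: "pi * cot (pi * x) = - (pi * tan (sqrt 5 * pi / 2))"
  proof -
    have "pi * x = pi / 2 + sqrt 5 * pi / 2" by (simp add: x_def s_def field_simps)
    then show ?thesis
      by (simp add: cot_def tan_def sin_add cos_add)
  qed
  have "1 / (x + real n) - 1 / (real (Suc n) - x) = - s * (1 / ((real n + 1)\<^sup>2 - (real n + 1) - 1))" for n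
  proof -
    have "real (Suc n) \<noteq> x"
      using nI by (metis Ints_of_nat)
    moreover have "x + real n \<noteq> 0" using x by simp
    moreover have "(x + real n) * (real (Suc n) - x) = (real n + 1)\<^sup>2 - (real n + 1) - 1"
      using s2 by (simp add: x_def field_simps power2_eq_square)
    ultimately show ?thesis
      by (simp add: x_def s_def [symmetric] diff_frac_eq flip: \<open>(x + real n) * _ = _\<close>)
  qed
  from sums_divide[OF cot_partial_fractions_real[OF nI, unfolded this cot], of "- s"]
  have "(\<lambda>n. 1 / ((real n + 1)\<^sup>2 - (real n + 1) - 1)) sums (pi / s * tan (sqrt 5 * pi / 2))"
    using s by simp
  from sums_split_initial_segment[OF this, of 2]
  show ?thesis by (simp add: s_def numeral_2_eq_2 algebra_simps power2_eq_square)
qed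

lemma summable_quartic_reciprocals:
  "summable (\<lambda>n. 1 / (real (Suc n) * (real (Suc n) + 1) * (real (Suc n) ^ 2 + 3 * real (Suc n) + 1)))"
proof (rule summable_comparison_test_bigo)
  show "summable (\<lambda>n. norm (1 / real n ^ 2))"
    using inverse_power_summable[of 2, where 'a = real] by (simp add: field_simps)
  show "(\<lambda>n. 1 / (real (Suc n) * (real (Suc n) + 1) * (real (Suc n) ^ 2 + 3 * real (Suc n) + 1)))
          \<in> O(\<lambda>n. 1 / real n ^ 2)"
    by real_asymp
qed

section \<open>Summation of Fibonacci-like sequences\<close>

text \<open>
  Multiplying the recurrence \<open>g (n + 4) = 3 g (n + 2) - g n\<close> by powers of \<open>1 / x\<close> and summing gives
  a linear equation for the sum. For convergence, nonnegativity turns that recurrence into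
  \<open>g (n + 4) \<le> 3 g (n + 2)\<close>, which with \<open>x\<^sup>2 \<ge> 4\<close> bounds the ratio of consecutive terms by \<open>3 / 4\<close>.
\<close>
lemma sums_fibonacci_like_even:
  fixes g :: "nat \<Rightarrow> real" and x :: real
  assumes rec: "\<And>n. g (n + 2) = g (n + 1) + g n" and nonneg: "\<And>n. 0 \<le> g n" and x: "2 \<le> x"
  shows "(\<lambda>k. g (2 * Suc k) / x ^ (2 * Suc k + 1)) sums
           ((g 2 * x\<^sup>2 - g 0) / (x * (x\<^sup>2 - x - 1) * ((x + 1)\<^sup>2 - (x + 1) - 1)))"
proof -
  define h where "h = (\<lambda>k. g (2 * Suc k) / x ^ (2 * Suc k + 1))"
  have g4: "g (n + 4) = 3 * g (n + 2) - g n" for n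
    using rec[of n] rec[of "n + 1"] rec[of "n + 2"] by (simp add: eval_nat_numeral)
  have x4: "4 \<le> x\<^sup>2" using power_mono[OF x, of 2] by simp
  have "summable h"
  proof (rule summable_ratio_test[of "3/4" 0])
    fix k :: nat
    have "g (2 * Suc (Suc k)) \<le> 3 * g (2 * Suc k)"
      using g4[of "2 * k"] nonneg[of "2 * k"] by (simp add: eval_nat_numeral)
    hence "g (2 * Suc (Suc k)) * 4 \<le> 3 * g (2 * Suc k) * x\<^sup>2"
      using x4 nonneg[of "2 * Suc k"] by (intro mult_mono) auto
    hence "g (2 * Suc (Suc k)) / x\<^sup>2 \<le> 3 / 4 * g (2 * Suc k)"
      using x4 x by (simp add: pos_divide_le_eq mult_ac)
    hence "g (2 * Suc (Suc k)) / x\<^sup>2 / x ^ (2 * Suc k + 1) \<le> 3 / 4 * g (2 * Suc k) / x ^ (2 * Suc k + 1)"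
      using x by (intro divide_right_mono) auto
    also have "g (2 * Suc (Suc k)) / x\<^sup>2 / x ^ (2 * Suc k + 1) = h (Suc k)"
      by (simp add: h_def power2_eq_square mult_ac)
    finally show "norm (h (Suc k)) \<le> 3 / 4 * norm (h k)"
      using x nonneg by (simp add: h_def)
  qed simp
  then obtain S where S: "h sums S" by (auto simp: summable_def)
  have S1: "(\<lambda>k. h (Suc k)) sums (S - h 0)" using S by (simp add: sums_Suc_iff)
  have S2: "(\<lambda>k. h (Suc (Suc k))) sums (S - h 0 - h 1)"
    using S1 by (subst sums_Suc_iff[of "\<lambda>k. h (Suc k)"]) simp
  have "h (Suc (Suc k)) = 3 / x\<^sup>2 * h (Suc k) - h k / x ^ 4" for k
    using x g4[of "2 * Suc k"]
    by (simp add: h_def field_simps power2_eq_square eval_nat_numeral)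
  with sums_diff[OF sums_mult[OF S1, of "3 / x\<^sup>2"] sums_divide[OF S, of "x ^ 4"]]
  have "(\<lambda>k. h (Suc (Suc k))) sums (3 / x\<^sup>2 * (S - h 0) - S / x ^ 4)" by simp
  with S2 have eq: "S - h 0 - h 1 = 3 / x\<^sup>2 * (S - h 0) - S / x ^ 4"
    using sums_unique2 by blast
  have h0: "h 0 = g 2 / x ^ 3" and h1: "h 1 = (3 * g 2 - g 0) / x ^ 5"
    using g4[of 0] by (auto simp: h_def eval_nat_numeral)
  \<comment> \<open>Multiplying \<open>eq\<close> by \<open>x ^ 5\<close> clears the denominators. Solving for \<open>S\<close> gives the
      stated rational function of \<open>x\<close>, since \<open>x\<^sup>4 - 3 x\<^sup>2 + 1 = (x\<^sup>2 - x - 1) (x\<^sup>2 + x - 1)\<close> and the last factor is \<open>(x + 1)\<^sup>2 - (x + 1) - 1\<close>.\<close>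
  have "x ^ 5 * h 1 = 3 * g 2 - g 0" "x ^ 5 * h 0 = g 2 * x\<^sup>2"
    unfolding h0 h1 using x by (simp_all add: eval_nat_numeral)
  hence "x ^ 5 * (S - h 0 - h 1) = x ^ 5 * S - g 2 * x\<^sup>2 - (3 * g 2 - g 0)"
    by (simp only: right_diff_distrib)
  moreover have "x ^ 5 * (3 / x\<^sup>2 * (S - h 0) - S / x ^ 4) = 3 * x ^ 3 * S - 3 * g 2 - x * S"
    unfolding h0 using x by (simp add: right_diff_distrib eval_nat_numeral)
  ultimately have "x ^ 5 * S - g 2 * x\<^sup>2 - (3 * g 2 - g 0) = 3 * x ^ 3 * S - 3 * g 2 - x * S"
    by (simp only: eq)
  hence "S * (x * (x ^ 4 - 3 * x\<^sup>2 + 1)) = g 2 * x\<^sup>2 - g 0"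
    by (simp add: algebra_simps eval_nat_numeral)
  moreover have "x * (x ^ 4 - 3 * x\<^sup>2 + 1) = x * (x\<^sup>2 - x - 1) * ((x + 1)\<^sup>2 - (x + 1) - 1)"
    by (simp add: eval_nat_numeral algebra_simps)
  moreover have "0 < x\<^sup>2 - x - 1" "0 < (x + 1)\<^sup>2 - (x + 1) - 1"
    using mult_right_mono[OF x, of x] x unfolding power2_eq_square distrib_left distrib_right
    by linarith+
  ultimately have "S = (g 2 * x\<^sup>2 - g 0) / (x * (x\<^sup>2 - x - 1) * ((x + 1)\<^sup>2 - (x + 1) - 1))"
    using x by (simp add: eq_divide_eq)
  with S show ?thesis by (simp add: h_def)
qed

text \<open>
  With \<open>N = x + 2\<close>, the left-hand side decomposes as
  \<open>- a / N + (b / 2 + a (N - 2) / 2) / P(N) - (b / 2 - a (N + 2) / 2) / P(N + 1)\<close>, and the quartic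
  reciprocal as \<open>1 / (N - 1) + 1 / N - (2 N + 3) / P(N + 1)\<close>. Adding \<open>2 / P(N + 1)\<close> to the latter
  leaves \<open>1 / (N - 1) + 1 / N - (2 N + 1) / P(N + 1)\<close>. The left-hand side and \<open>- a / 2\<close> times this sum then
  differ by terms of the form \<open>u x - u (x + 1)\<close>, from which \<open>u\<close> can be read off.
\<close>
lemma partial_fractions_telescoping:
  fixes x a b :: real
  assumes "0 \<le> x"
  defines "P \<equiv> \<lambda>y. y\<^sup>2 - y - 1"
  defines "u \<equiv> \<lambda>y. b / 2 / P (y + 2) + a / 2 * (1 / (y + 1) + y / P (y + 2))"
  shows "(b * (x + 2)\<^sup>2 - a) / ((x + 2) * P (x + 2) * P (x + 3)) =
           u x - u (x + 1)
           - a / 2 * (1 / ((x + 1) * (x + 2) * ((x + 1)\<^sup>2 + 3 * (x + 1) + 1)) + 2 * (1 / P (x + 3)))"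
proof -
  define p q where "p = P (x + 2)" and "q = P (x + 3)"
  have p: "p = x\<^sup>2 + 3 * x + 1" and q: "q = x\<^sup>2 + 5 * x + 5"
    by (auto simp: p_def q_def P_def power2_eq_square algebra_simps)
  have 1: "(x + 1)\<^sup>2 + 3 * (x + 1) + 1 = q" by (simp add: q power2_eq_square algebra_simps)
  have pos: "0 < p" "0 < q" using assms(1) by (auto simp: p q intro!: add_nonneg_pos)
  have e: "x + 1 + 2 = x + 3" "x + 1 + 1 = x + 2" by simp_all
  show ?thesis
    unfolding u_def e 1 p_def[symmetric] q_def[symmetric] using pos assms(1)
    by (simp add: divide_simps) (simp add: p q power2_eq_square algebra_simps)
qed

lemma sums_swap_nonneg:
  fixes f :: "nat \<Rightarrow> nat \<Rightarrow> real"
  assumes nonneg: "\<And>n k. 0 \<le> f n k"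
    and rows: "\<And>n. f n sums a n" and total: "a sums S" and columns: "\<And>k. (\<lambda>n. f n k) sums b k"
  shows "b sums S"
proof -
  have a0: "0 \<le> a n" for n using rows[of n] nonneg sums_le[OF _ sums_zero] by blast
  have r: "((\<lambda>k. case_prod f (n, k)) has_sum a n) UNIV" for n
    using sums_nonneg_imp_has_sum[OF rows nonneg] by simp
  have t: "(a has_sum S) UNIV" by (rule sums_nonneg_imp_has_sum[OF total a0])
  have "case_prod f summable_on UNIV \<times> UNIV"
    using r t nonneg by (intro summable_on_SigmaI[where g = a]) (auto simp: summable_on_def)
  with r t have "(case_prod f has_sum S) (UNIV \<times> UNIV)"
    by (intro has_sum_SigmaI[where g = a])
  hence "((\<lambda>(k, n). f n k) has_sum S) (UNIV \<times> UNIV)"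
    by (subst (asm) has_sum_swap) simp
  hence "(b has_sum S) UNIV"
    by (rule has_sum_SigmaD) (use sums_nonneg_imp_has_sum[OF columns nonneg] in simp)
  thus ?thesis by (rule has_sum_imp_sums)
qed

lemma zeta_minus_one_sums:
  assumes "2 \<le> p"
  obtains Z :: real where "zeta (of_nat p) - 1 = of_real Z" "(\<lambda>n. 1 / (real n + 2) ^ p) sums Z"
proof -
  have "summable (\<lambda>n. 1 / real (Suc n) ^ p)"
    using inverse_power_summable[OF assms, where 'a = real] 
    by (subst summable_Suc_iff) (simp add: field_simps)
  then obtain Z where Z: "(\<lambda>n. 1 / real (Suc n) ^ p) sums Z" by (auto simp: summable_def)
  have "complex_of_real (1 / real (Suc n) ^ p) = of_nat (Suc n) powr (- of_nat p)" for n
    by (simp add: powr_minus powr_nat' field_simps del: of_nat_Suc)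
  with Z have "(\<lambda>n. of_nat (Suc n) powr (- of_nat p)) sums complex_of_real Z"
    by (metis (no_types, lifting) sums_cong sums_of_real)
  hence "zeta (of_nat p) = of_real Z" unfolding zeta_def by (simp add: sums_iff)
  moreover have "(\<lambda>n. 1 / (real n + 2) ^ p) sums (Z - 1)"
    using sums_split_initial_segment[OF Z, of 1] by (simp add: add_ac)
  ultimately show thesis by (intro that[of "Z - 1"]) auto
qed

lemma sums_zeta_fibonacci_like:
  fixes g :: "nat \<Rightarrow> nat"
  assumes rec: "\<And>n. g (n + 2) = g (n + 1) + g n"
  shows "(\<lambda>k. (zeta (of_nat (2 * Suc k + 1)) - 1) * of_nat (g (2 * Suc k + m))) sums
           complex_of_real
             ((real (g m) + real (g (m + 2))) / 2
              - real (g m) * (pi / sqrt 5) * tan (sqrt 5 * pi / 2)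
              - real (g m) / 2 *
                (\<Sum>n. 1 / (real (Suc n) * (real (Suc n) + 1) * (real (Suc n) ^ 2 + 3 * real (Suc n) + 1))))"
proof -
  define a b where "a = real (g m)" and "b = real (g (m + 2))"
  define P where "P = (\<lambda>y::real. y\<^sup>2 - y - 1)"
  define u where "u = (\<lambda>y. b / 2 / P (y + 2) + a / 2 * (1 / (y + 1) + y / P (y + 2)))"
  define T where "T = (\<lambda>n. 1 / (real (Suc n) * (real (Suc n) + 1) * (real (Suc n) ^ 2 + 3 * real (Suc n) + 1)))"
  define \<tau> where "\<tau> = pi / sqrt 5 * tan (sqrt 5 * pi / 2)"
  define f where "f = (\<lambda>n k. real (g (2 * Suc k + m)) / (real n + 2) ^ (2 * Suc k + 1))"
  define A where "A = (\<lambda>n. (b * (real n + 2)\<^sup>2 - a) / ((real n + 2) * P (real n + 2) * P (real n + 3)))"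
  have rows: "f n sums A n" for n
    using sums_fibonacci_like_even[of "\<lambda>i. real (g (i + m))" "real n + 2"] rec[of "_ + m"]
    by (simp add: f_def A_def P_def a_def b_def add_ac)
  have "(\<lambda>n. u (real n)) \<longlonglongrightarrow> 0" unfolding u_def P_def by real_asymp
  from telescope_sums'[OF this] have "(\<lambda>n. u (real n) - u (real n + 1)) sums (b / 2 + a / 2)"
    by (simp add: u_def P_def add_ac)
  moreover have "(\<lambda>n. a / 2 * (T n + 2 * (1 / P (real n + 3)))) sums (a / 2 * (suminf T + 2 * \<tau>))"
    unfolding T_def P_def \<tau>_def
    by (intro sums_mult sums_add summable_sums summable_quartic_reciprocals
          sums_inverse_golden_polynomial)
  ultimately have "(\<lambda>n. u (real n) - u (real n + 1) - a / 2 * (T n + 2 * (1 / P (real n + 3))))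
      sums (b / 2 + a / 2 - a / 2 * (suminf T + 2 * \<tau>))"
    by (rule sums_diff)
  moreover have "u (real n) - u (real n + 1) - a / 2 * (T n + 2 * (1 / P (real n + 3))) = A n" for n
    using partial_fractions_telescoping[of "real n" b a]
    by (simp add: u_def P_def T_def A_def add_ac)
  ultimately have total: "A sums (b / 2 + a / 2 - a / 2 * (suminf T + 2 * \<tau>))" by simp
  have "\<exists>Z. zeta (of_nat (2 * Suc k + 1)) - 1 = of_real Z \<and>
            (\<lambda>n. 1 / (real n + 2) ^ (2 * Suc k + 1)) sums Z" for k
    by (rule zeta_minus_one_sums[of "2 * Suc k + 1"]) auto
  then obtain Z where Z: "\<And>k. zeta (of_nat (2 * Suc k + 1)) - 1 = of_real (Z k)"
      "\<And>k. (\<lambda>n. 1 / (real n + 2) ^ (2 * Suc k + 1)) sums Z k"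
    by metis
  have "(\<lambda>k. Z k * real (g (2 * Suc k + m))) sums (b / 2 + a / 2 - a / 2 * (suminf T + 2 * \<tau>))"
  proof (rule sums_swap_nonneg[OF _ rows total])
    show "(\<lambda>n. f n k) sums (Z k * real (g (2 * Suc k + m)))" for k
      using sums_mult2[OF Z(2)[of k], of "real (g (2 * Suc k + m))"] by (simp add: f_def)
  qed (simp add: f_def)
  also have "b / 2 + a / 2 - a / 2 * (suminf T + 2 * \<tau>)
      = (a + b) / 2 - a * (pi / sqrt 5) * tan (sqrt 5 * pi / 2) - a / 2 * suminf T" (is "_ = ?S")
    by (simp add: \<tau>_def field_simps)
  finally have "(\<lambda>k. complex_of_real (Z k * real (g (2 * Suc k + m)))) sums complex_of_real ?S"
    by (rule sums_of_real)
  hence "(\<lambda>k. complex_of_real (Z k) * of_nat (g (2 * Suc k + m))) sums complex_of_real ?S"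
    unfolding of_real_mult of_real_of_nat_eq .
  thus ?thesis unfolding Z(1) a_def b_def T_def .
qed

theorem theorem2p5:
  fixes m :: nat
  shows "summable (\<lambda>n. 1 / (real (Suc n) * (real (Suc n) + 1) * (real (Suc n) ^ 2 + 3 * real (Suc n) + 1)))
    \<and> (\<lambda>k. (zeta (of_nat (2 * Suc k + 1)) - 1) * of_nat (fib (2 * Suc k + m))) sums
           complex_of_real
             ((real (fib m) + real (fib (m + 2))) / 2
              - real (fib m) * (pi / sqrt 5) * tan (sqrt 5 * pi / 2)
              - real (fib m) / 2 *
                (\<Sum>n. 1 / (real (Suc n) * (real (Suc n) + 1) * (real (Suc n) ^ 2 + 3 * real (Suc n) + 1))))
    \<and> (\<lambda>k. (zeta (of_nat (2 * Suc k + 1)) - 1) * of_nat (lucas (2 * Suc k + m))) sums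
           complex_of_real
             ((real (lucas m) + real (lucas (m + 2))) / 2
              - real (lucas m) * (pi / sqrt 5) * tan (sqrt 5 * pi / 2)
              - real (lucas m) / 2 *
                (\<Sum>n. 1 / (real (Suc n) * (real (Suc n) + 1) * (real (Suc n) ^ 2 + 3 * real (Suc n) + 1))))"
  by (intro conjI summable_quartic_reciprocals sums_zeta_fibonacci_like)
     (simp_all add: numeral_2_eq_2)

end
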